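(* Let $V$ be an $L_1$ component such that the compiler ${\downarrow}^1_2$ preserves traces of $V$, and suppose the trace relation is invertible. Then for every $L_3$ context $A$, $A\in\mathsf{TExploit}^2_3({\downarrow}^1_2V)$ implies $A\in\mathsf{TExploit}^1_3(V)$.
   Context: There are three languages $L_1,L_2,L_3$. Each $L_i$ has whole programs, components, contexts, and a set of traces $\mathsf{Trace}^i$; behaviors are sets of traces. Linking a context $C$ with a component $U$ of the same language gives a whole program $C[U]$ (assumed always well-defined). Each whole program $P$ of $L_i$ has a behavior $B(P)\subseteq\mathsf{Trace}^i$. There are compilers ${\downarrow}^1_2$ (from $L_1$ to $L_2$) and ${\downarrow}^2_3$ (from $L_2$ to $L_3$), each mapping whole programs, components and contexts to whole programs, components and contexts respectively, and each modular: $B({\downarrow}(C[U]))=B({\downarrow}C[{\downarrow}U])$. Their composite (first ${\downarrow}^1_2$, then ${\downarrow}^2_3$) is ${\downarrow}^1_3$. Arbitrary relations $\mapsto^1_2\subseteq\mathsf{Trace}^1\times\mathsf{Trace}^2$ and $\mapsto^2_3\subseteq\mathsf{Trace}^2\times\mathsf{Trace}^3$ are given, and $t^1\mapsto^1_3t^3$ means that there exists $t^2\in\mathsf{Trace}^2$ with $t^1\mapsto^1_2t^2$ and $t^2\mapsto^2_3t^3$. An attacker set $\mathcal{A}_3$ of $L_3$ contexts is fixed. For $i\in\{1,2\}$ and an $L_i$ component $V$, $$\mathsf{TExploit}^i_3(V)=\{A\in\mathcal{A}_3\mid\exists\,t^3\in B(A[{\downarrow}^i_3V]).\ \forall\, L_i\text{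 contexts } C.\ \forall t^i\in B(C[V]).\ t^i\not\mapsto^i_3t^3\}.$$ The compiler ${\downarrow}^i_j$ preserves traces of an $L_i$ component $U$ if for every $L_i$ context $C$ and every $t^i\in B(C[U])$ there exists $t^j\in B({\downarrow}^i_jC[{\downarrow}^i_jU])$ with $t^i\mapsto^i_jt^j$. The trace relation is invertible if, whenever $t^1\mapsto^1_3t^3$, for all $t^2\in\mathsf{Trace}^2$ we have $t^1\mapsto^1_2t^2\iff t^2\mapsto^2_3t^3$. *)

theory Defs
  imports Main
begin

(* 'p: whole programs, 'u: components, 'c: contexts, 't: traces *)
record ('p, 'u, 'c, 't) language =
  link :: "'c \<Rightarrow> 'u \<Rightarrow> 'p"
  behavior :: "'p \<Rightarrow> 't set"

record ('p, 'u, 'c, 'q, 'v, 'd) compiler =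
  cprog :: "'p \<Rightarrow> 'q"
  ccomp :: "'u \<Rightarrow> 'v"
  cctx :: "'c \<Rightarrow> 'd"

definition modular ::
  "('p, 'u, 'c, 't) language \<Rightarrow> ('q, 'v, 'd, 's) language \<Rightarrow>
   ('p, 'u, 'c, 'q, 'v, 'd) compiler \<Rightarrow> bool" where
  "modular S T K \<longleftrightarrow>
     (\<forall>C U. behavior T (cprog K (link S C U)) =
            behavior T (link T (cctx K C) (ccomp K U)))"

(* The first argument is the compiler that runs first. *)
definition compose_compilers ::
  "('p, 'u, 'c, 'q, 'v, 'd) compiler \<Rightarrow> ('q, 'v, 'd, 'r, 'w, 'e) compiler \<Rightarrow>
   ('p, 'u, 'c, 'r, 'w, 'e) compiler" where
  "compose_compilers K K' =
     \<lparr> cprog = cprog K' \<circ> cprog K,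
       ccomp = ccomp K' \<circ> ccomp K,
       cctx = cctx K' \<circ> cctx K \<rparr>"

definition TExploit ::
  "('p, 'u, 'c, 't) language \<Rightarrow> ('q, 'v, 'd, 's) language \<Rightarrow>
   ('p, 'u, 'c, 'q, 'v, 'd) compiler \<Rightarrow> ('t \<Rightarrow> 's \<Rightarrow> bool) \<Rightarrow> 'd set \<Rightarrow> 'u \<Rightarrow> 'd set" where
  "TExploit S T K R \<A> V =
     {A \<in> \<A>. \<exists>t' \<in> behavior T (link T A (ccomp K V)).
                \<forall>C. \<forall>t \<in> behavior S (link S C V). \<not> R t t'}"

definition preserves_traces ::
  "('p, 'u, 'c, 't) language \<Rightarrow> ('q, 'v, 'd, 's) language \<Rightarrow>
   ('p, 'u, 'c, 'q, 'v, 'd) compiler \<Rightarrow> ('t \<Rightarrow> 's \<Rightarrow> bool) \<Rightarrow> 'u \<Rightarrow> bool" where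
  "preserves_traces S T K R U \<longleftrightarrow>
     (\<forall>C. \<forall>t \<in> behavior S (link S C U).
        \<exists>t' \<in> behavior T (link T (cctx K C) (ccomp K U)). R t t')"

definition invertible_trace_rel ::
  "('t1 \<Rightarrow> 't2 \<Rightarrow> bool) \<Rightarrow> ('t2 \<Rightarrow> 't3 \<Rightarrow> bool) \<Rightarrow> bool" where
  "invertible_trace_rel R12 R23 \<longleftrightarrow>
     (\<forall>t1 t3. (R12 OO R23) t1 t3 \<longrightarrow> (\<forall>t2. R12 t1 t2 \<longleftrightarrow> R23 t2 t3))"

end

theory Submission
  imports Defs
begin

text \<open>The trace \<open>t3\<close> witnessing the exploit at \<open>L2\<close> also witnesses
  it at \<open>L1\<close>. If some \<open>C\<close> had a trace \<open>t1\<close> related to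
  \<open>t3\<close>, trace preservation would give \<open>t1\<close> a partner \<open>t2\<close>
  produced by the compiled context, and invertibility would relate \<open>t2\<close> to
  \<open>t3\<close>, although no \<open>L2\<close> context accounts for \<open>t3\<close>.\<close>

theorem mainTheorem9:
  fixes L1 :: "('p1, 'u1, 'c1, 't1) language"
    and L2 :: "('p2, 'u2, 'c2, 't2) language"
    and L3 :: "('p3, 'u3, 'c3, 't3) language"
    and K12 :: "('p1, 'u1, 'c1, 'p2, 'u2, 'c2) compiler"
    and K23 :: "('p2, 'u2, 'c2, 'p3, 'u3, 'c3) compiler"
    and R12 :: "'t1 \<Rightarrow> 't2 \<Rightarrow> bool"
    and R23 :: "'t2 \<Rightarrow> 't3 \<Rightarrow> bool"
    and \<A>3 :: "'c3 set"
    and V :: 'u1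
    and A :: 'c3
  assumes "modular L1 L2 K12"
    and "modular L2 L3 K23"
    and "preserves_traces L1 L2 K12 R12 V"
    and "invertible_trace_rel R12 R23"
    and "A \<in> TExploit L2 L3 K23 R23 \<A>3 (ccomp K12 V)"
  shows "A \<in> TExploit L1 L3 (compose_compilers K12 K23) (R12 OO R23) \<A>3 V"
proof -
  from assms(5) obtain t3 where "A \<in> \<A>3"
    and t3: "t3 \<in> behavior L3 (link L3 A (ccomp K23 (ccomp K12 V)))"
    and unmatched: "\<And>C t2. t2 \<in> behavior L2 (link L2 C (ccomp K12 V)) \<Longrightarrow> \<not> R23 t2 t3"
    unfolding TExploit_def by blast
  have "\<not> (R12 OO R23) t1 t3" if t1: "t1 \<in> behavior L1 (link L1 C V)" for C t1
  proof
    assume related: "(R12 OO R23) t1 t3"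
    from assms(3) t1 obtain t2
      where t2: "t2 \<in> behavior L2 (link L2 (cctx K12 C) (ccomp K12 V))" and "R12 t1 t2"
      unfolding preserves_traces_def by blast
    \<comment> \<open>The \<open>L2\<close> trace inside \<open>related\<close> need not be a behavior of the compiled program;
      invertibility lets \<open>t2\<close> replace it.\<close>
    with assms(4) related have "R23 t2 t3"
      unfolding invertible_trace_rel_def by blast
    with unmatched t2 show False by blast
  qed
  \<comment> \<open>The composite compiler sends \<open>V\<close> to
    \<open>ccomp K23 (ccomp K12 V)\<close>, so both exploits concern the same \<open>L3\<close>
    program.\<close>
  with \<open>A \<in> \<A>3\<close> t3 show ?thesis
    unfolding TExploit_def compose_compilers_def by auto
qed

end
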